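(* Let $\mathcal{D}(v,k)$ be as defined in the context. If $v\equiv 1$ or $3 \pmod 6$ and $v\geq 13$, then $\mathcal{D}(v,k)\leq v-7$ for every $k\geq \lfloor v/3\rfloor+1$ with $k\neq \frac{v-1}{2}$.
   Context: A $(2,3)$-packing on a $v$-set $V$ is a pair $(V,\mathcal{A})$ where $\mathcal{A}$ is a set of $3$-subsets (blocks) of $V$ such that each pair of distinct points of $V$ lies in at most one block. Its leave is the graph $(V,E)$ where $E$ consists of all pairs lying in no block. A $(2,3)$-packing is maximum if no $(2,3)$-packing on $V$ has more blocks (for $v\equiv 1,3 \pmod 6$ these are exactly the Steiner triple systems of order $v$). $\mathcal{D}(v,k)$ denotes the maximum number $t$ of maximum $(2,3)$-packings $(V,\mathcal{A}_1),\dots,(V,\mathcal{A}_t)$ on a $v$-set $V$, all having the same leave, such that there is a set $A$ of $k$ blocks with $\mathcal{A}_i\cap\mathcal{A}_j=A$ for all $i\neq j$. *)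

theory Defs
  imports Main
begin

definition triples :: "'a set \<Rightarrow> 'a set set" where
  "triples V = {B. B \<subseteq> V \<and> card B = 3}"

definition packing :: "'a set \<Rightarrow> 'a set set \<Rightarrow> bool" where
  "packing V \<A> \<longleftrightarrow> \<A> \<subseteq> triples V \<and>
     (\<forall>x\<in>V. \<forall>y\<in>V. x \<noteq> y \<longrightarrow> (\<exists>\<^sub>\<le>\<^sub>1 B. B \<in> \<A> \<and> x \<in> B \<and> y \<in> B))"

definition leave :: "'a set \<Rightarrow> 'a set set \<Rightarrow> 'a set \<times> 'a set set" where
  "leave V \<A> = (V, {{x, y} | x y. x \<in> V \<and> y \<in> V \<and> x \<noteq> y \<and> \<not> (\<exists>B\<in>\<A>. x \<in> B \<and> y \<in> B)})"

definition maximum_packing :: "'a set \<Rightarrow> 'a set set \<Rightarrow> bool" where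
  "maximum_packing V \<A> \<longleftrightarrow> packing V \<A> \<and> (\<forall>\<B>. packing V \<B> \<longrightarrow> card \<B> \<le> card \<A>)"

text \<open>The packings of a family are pairwise distinct. This matters only when \<open>k\<close> is the
  number of blocks of a maximum packing: otherwise equality of two members already contradicts
  \<open>\<A> i \<inter> \<A> j = A\<close>, whereas there one packing could be repeated arbitrarily often and no
  maximum would exist.\<close>

definition intersecting_family ::
    "'a set \<Rightarrow> nat \<Rightarrow> nat \<Rightarrow> (nat \<Rightarrow> 'a set set) \<Rightarrow> bool" where
  "intersecting_family V k t \<A> \<longleftrightarrow>
     inj_on \<A> {..<t} \<and>
     (\<forall>i<t. maximum_packing V (\<A> i)) \<and>
     (\<forall>i<t. \<forall>j<t. leave V (\<A> i) = leave V (\<A> j)) \<and>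
     (\<exists>A. A \<subseteq> triples V \<and> card A = k \<and> (\<forall>i<t. \<forall>j<t. i \<noteq> j \<longrightarrow> \<A> i \<inter> \<A> j = A))"

definition family_sizes :: "nat \<Rightarrow> nat \<Rightarrow> nat set" where
  "family_sizes v k =
     {t. \<exists>(V :: nat set) \<A>. finite V \<and> card V = v \<and> intersecting_family V k t \<A>}"

text \<open>The supremum is a maximum whenever \<open>family_sizes v k\<close> is nonempty (\<open>D_is_max\<close> below); that
  set is empty, and \<open>D v k = 0\<close>, only if a \<open>v\<close>-set has fewer than \<open>k\<close> triples.\<close>

definition D :: "nat \<Rightarrow> nat \<Rightarrow> nat" where
  "D v k = Sup (family_sizes v k)"

lemma finite_family_sizes: "finite (family_sizes v k)"
proof (rule finite_subset)
  show "family_sizes v k \<subseteq> {..2 ^ (2 ^ v)}"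
  proof
    fix t assume "t \<in> family_sizes v k"
    then obtain V :: "nat set" and \<A>
      where V: "finite V" "card V = v" and F: "intersecting_family V k t \<A>"
      unfolding family_sizes_def by blast
    have "\<A> ` {..<t} \<subseteq> Pow (Pow V)"
      using F unfolding intersecting_family_def maximum_packing_def packing_def triples_def
      by blast
    moreover have "inj_on \<A> {..<t}"
      using F unfolding intersecting_family_def by blast
    ultimately have "card {..<t} \<le> card (Pow (Pow V))"
      using V(1) by (intro card_inj_on_le) auto
    then show "t \<in> {..2 ^ (2 ^ v)}"
      using V by (simp add: card_Pow)
  qed
qed simp

lemma D_is_max:
  assumes "family_sizes v k \<noteq> {}"
  shows "D v k \<in> family_sizes v k" and "\<And>t. t \<in> family_sizes v k \<Longrightarrow> t \<le> D v k"
  using assms finite_family_sizes[of v k] by (auto simp: D_def Sup_nat_def)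

end

theory Submission
  imports Defs
begin

text \<open>
  By the constructions of Bose and Skolem, Steiner triple systems of order \<open>v\<close> exist, so each
  maximum packing covers every pair. Let \<open>A\<close> be the common part of \<open>t \<ge> v - 6\<close> systems and let
  \<open>N(x)\<close> be the set of points joined to \<open>x\<close> by a block of \<open>A\<close>. If \<open>A\<close> does not cover the pair
  \<open>{x, y}\<close>, the \<open>t\<close> systems complete it by \<open>t\<close> different points outside \<open>{x, y} \<union> N(x) \<union> N(y)\<close>,
  whence \<open>|N(x) \<union> N(y)| \<le> 4\<close>. If a point \<open>y\<close> that is not joined to everything has \<open>|N(y)| = 4\<close>,
  then \<open>N(z) \<subseteq> N(y)\<close> for every \<open>z\<close> outside \<open>N(y)\<close>, so that every block of \<open>A\<close> has two
  points in \<open>N(y)\<close>; since the points of \<open>N(y)\<close> lie on at most two blocks each, \<open>k \<le> 4\<close>.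
  Otherwise each point that is not joined to everything lies on at most one block of \<open>A\<close>, and
  then \<open>A\<close> is either a partial parallel class, with \<open>k \<le> v/3\<close>, or the set of all
  \<open>(v - 1)/2\<close> blocks through one point.
\<close>

section \<open>Triple systems that cover all pairs\<close>

definition covers_pairs :: "'a set \<Rightarrow> 'a set set \<Rightarrow> bool" where
  "covers_pairs V \<B> \<longleftrightarrow> (\<forall>x\<in>V. \<forall>y\<in>V. x \<noteq> y \<longrightarrow> (\<exists>B\<in>\<B>. x \<in> B \<and> y \<in> B))"

lemma finite_triples: "finite V \<Longrightarrow> finite (triples V)"
  unfolding triples_def by simp

lemma packing_unique:
  assumes "packing V \<A>" "B \<in> \<A>" "C \<in> \<A>" "x \<in> B" "y \<in> B" "x \<in> C" "y \<in> C" "x \<noteq> y"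
  shows "B = C"
proof -
  have "x \<in> V" "y \<in> V"
    using assms unfolding packing_def triples_def by auto
  then show ?thesis
    using assms unfolding packing_def Uniq_def by blast
qed

lemma packing_subset: "packing V \<A> \<Longrightarrow> \<B> \<subseteq> \<A> \<Longrightarrow> packing V \<B>"
  unfolding packing_def Uniq_def by blast

lemma packing_finite: "packing V \<A> \<Longrightarrow> finite V \<Longrightarrow> finite \<A>"
  unfolding packing_def by (meson finite_subset finite_triples)

lemma packing_blockD: "packing V \<A> \<Longrightarrow> B \<in> \<A> \<Longrightarrow> B \<subseteq> V \<and> card B = 3"
  unfolding packing_def triples_def by auto

section \<open>Double counting of pairs in blocks\<close>

text \<open>Incidences of pairs and blocks are counted in two ways; a triple contains three
  pairs.\<close>

lemma sum_pair_multiplicities: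
  assumes "finite V" "\<B> \<subseteq> triples V"
  shows "(\<Sum>p\<in>{p. p \<subseteq> V \<and> card p = 2}. card {B\<in>\<B>. p \<subseteq> B}) = 3 * card \<B>"
proof -
  have "card {p \<in> {p. p \<subseteq> V \<and> card p = 2}. p \<subseteq> B} = 3" if "B \<in> \<B>" for B
  proof -
    have B: "B \<subseteq> V" "card B = 3"
      using that assms(2) unfolding triples_def by auto
    then have "{p \<in> {p. p \<subseteq> V \<and> card p = 2}. p \<subseteq> B} = {p. p \<subseteq> B \<and> card p = 2}"
      by auto
    moreover have "finite B"
      using B assms(1) finite_subset by blast
    ultimately show ?thesis
      using B by (simp add: n_subsets choose_two)
  qed
  moreover have "finite \<B>"
    using assms finite_triples finite_subset by blast
  ultimately show ?thesis
    using assms(1) by (subst sum_multicount_gen[where k = "\<lambda>_. 3"]) auto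
qed

lemma card_pairs: "finite V \<Longrightarrow> 2 * card {p. p \<subseteq> V \<and> card p = 2} = card V * (card V - 1)"
  by (cases "card V") (simp_all add: n_subsets choose_two)

lemma packing_pair_multiplicity_le:
  assumes "finite V" "packing V \<A>" "card p = 2"
  shows "card {B\<in>\<A>. p \<subseteq> B} \<le> 1"
proof -
  obtain x y where p: "p = {x, y}" "x \<noteq> y"
    using assms(3) by (auto simp: card_2_iff)
  have "finite {B\<in>\<A>. p \<subseteq> B}"
    using packing_finite[OF assms(2,1)] by simp
  then show ?thesis
    using packing_unique[OF assms(2)] p by (subst One_nat_def, subst card_le_Suc0_iff_eq) auto
qed

text \<open>The multiplicities of the pairs are all at least 1, and by the bound on
  \<open>card \<B>\<close> their sum is at most the number of pairs, so each is exactly 1. A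
  construction thus has to be checked only for covering and for an upper bound on its number of
  blocks.\<close>

lemma covers_pairs_packing:
  assumes "finite V" "\<B> \<subseteq> triples V" "covers_pairs V \<B>"
    and "6 * card \<B> \<le> card V * (card V - 1)"
  shows "packing V \<B>" and "6 * card \<B> = card V * (card V - 1)"
proof -
  define P where "P = {p. p \<subseteq> V \<and> card p = 2}"
  define m where "m p = card {B\<in>\<B>. p \<subseteq> B}" for p
  have fin: "finite P" "finite \<B>"
    using assms(1,2) finite_triples finite_subset unfolding P_def by auto
  have sum: "(\<Sum>p\<in>P. m p) = 3 * card \<B>"
    using sum_pair_multiplicities[OF assms(1,2)] unfolding P_def m_def .
  have P: "2 * card P = card V * (card V - 1)"
    using card_pairs[OF assms(1)] unfolding P_def .
  have ge: "1 \<le> m p" if pP: "p \<in> P" for p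
  proof -
    obtain x y where p: "p = {x, y}" "x \<noteq> y"
      using pP unfolding P_def card_2_iff by blast
    have "x \<in> V" "y \<in> V"
      using pP p unfolding P_def by auto
    then obtain B where "B \<in> \<B>" "x \<in> B" "y \<in> B"
      using assms(3) p(2) unfolding covers_pairs_def by blast
    then have "{B\<in>\<B>. p \<subseteq> B} \<noteq> {}"
      using p by auto
    then show ?thesis
      unfolding m_def using fin by (simp add: Suc_le_eq card_gt_0_iff)
  qed
  have "card P \<le> (\<Sum>p\<in>P. m p)"
    using sum_mono[of P "\<lambda>_. 1" m] ge by simp
  then have eq: "(\<Sum>p\<in>P. m p) = card P"
    using sum P assms(4) by linarith
  then show "6 * card \<B> = card V * (card V - 1)"
    using sum P by linarith
  have one: "m p = 1" if "p \<in> P" for p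
  proof (rule ccontr)
    assume "m p \<noteq> 1"
    then have "1 < m p"
      using ge[OF that] by simp
    then have "(\<Sum>p\<in>P. 1) < (\<Sum>p\<in>P. m p)"
      using that ge fin by (intro sum_strict_mono_ex1) auto
    then show False
      using eq by simp
  qed
  have "B = C" if "x \<in> V" "y \<in> V" "x \<noteq> y" "B \<in> \<B>" "C \<in> \<B>" "x \<in> B" "y \<in> B" "x \<in> C" "y \<in> C"
    for x y B C
  proof -
    have "m {x, y} = 1"
      using that by (intro one) (auto simp: P_def)
    moreover have "B \<in> {B\<in>\<B>. {x, y} \<subseteq> B}" "C \<in> {B\<in>\<B>. {x, y} \<subseteq> B}"
      using that by auto
    ultimately show ?thesis
      unfolding m_def by (metis card_1_singletonE singletonD)
  qed
  then show "packing V \<B>"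
    using assms(2) unfolding packing_def Uniq_def by blast
qed

text \<open>The counterpart of the previous count: the multiplicities are at most 1 and their sum is
  at least the number of pairs, so none of them is 0.\<close>

lemma packing_covers_pairs:
  assumes "finite V" "packing V \<A>" "card V * (card V - 1) \<le> 6 * card \<A>"
  shows "covers_pairs V \<A>"
  unfolding covers_pairs_def
proof (intro ballI impI)
  fix x y assume xy: "x \<in> V" "y \<in> V" "x \<noteq> y"
  define P where "P = {p. p \<subseteq> V \<and> card p = 2}"
  define m where "m p = card {B\<in>\<A>. p \<subseteq> B}" for p
  have fin: "finite P"
    using assms(1) unfolding P_def by simp
  have sum: "(\<Sum>p\<in>P. m p) = 3 * card \<A>"
    using sum_pair_multiplicities[OF assms(1)] assms(2) unfolding P_def m_def packing_def by blast
  have le: "m p \<le> 1" if "p \<in> P" for p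
    using packing_pair_multiplicity_le[OF assms(1,2)] that unfolding P_def m_def by simp
  have xyP: "{x, y} \<in> P"
    using xy unfolding P_def by simp
  have "m {x, y} \<noteq> 0"
  proof
    assume "m {x, y} = 0"
    then have "(\<Sum>p\<in>P. m p) < (\<Sum>p\<in>P. 1)"
      using le fin xyP by (intro sum_strict_mono_ex1) (auto intro!: bexI[of _ "{x, y}"])
    then show False
      using sum card_pairs[OF assms(1)] assms(3) unfolding P_def by simp
  qed
  then have "{B\<in>\<A>. {x, y} \<subseteq> B} \<noteq> {}"
    unfolding m_def by (metis card.empty)
  then show "\<exists>B\<in>\<A>. x \<in> B \<and> y \<in> B"
    by auto
qed

section \<open>Existence of Steiner triple systems\<close>

lemma card_less_pairs: "2 * card (SIGMA y:{..<m::nat}. {..<y}) = m * (m - 1)"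
  by (induction m) (auto simp: algebra_simps lessThan_Suc)

lemma other_residue_mod_3:
  fixes i j :: nat
  assumes "i < 3" "j < 3" "i \<noteq> j"
  shows "j = (i + 1) mod 3 \<or> i = (j + 1) mod 3"
proof -
  have "i = 0 \<or> i = 1 \<or> i = 2" "j = 0 \<or> j = 1 \<or> j = 2"
    using assms by linarith+
  then show ?thesis
    using assms by auto
qed

text \<open>In the Bose and Skolem constructions, the commutative quasigroup is \<open>x \<circ> y = f (x + y)\<close>.\<close>

definition quasigroup_block :: "(nat \<Rightarrow> nat) \<Rightarrow> (nat \<times> nat) \<times> nat \<Rightarrow> (nat \<times> nat) set" where
  "quasigroup_block f = (\<lambda>((y, x), i). {(x, i), (y, i), (f (x + y), (i + 1) mod 3)})"

text \<open>The index set lists every unordered pair of distinct elements once, the larger element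
  first.\<close>

definition quasigroup_blocks :: "(nat \<Rightarrow> nat) \<Rightarrow> nat \<Rightarrow> (nat \<times> nat) set set" where
  "quasigroup_blocks f m = quasigroup_block f ` ((SIGMA y:{..<m}. {..<y}) \<times> {..<3})"

lemma card_quasigroup_blocks_le: "2 * card (quasigroup_blocks f m) \<le> 3 * (m * (m - 1))"
proof -
  have "card (quasigroup_blocks f m) \<le> card ((SIGMA y:{..<m}. {..<y}) \<times> {..<3::nat})"
    unfolding quasigroup_blocks_def by (intro card_image_le) auto
  then show ?thesis
    using card_less_pairs[of m] by (simp add: card_cartesian_product)
qed

lemma quasigroup_blocks_triples:
  assumes "\<And>s. f s < m"
  shows "quasigroup_blocks f m \<subseteq> triples ({..<m} \<times> {..<3})"
proof
  fix B assume "B \<in> quasigroup_blocks f m"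
  then obtain x y i where B: "B = {(x, i), (y, i), (f (x + y), (i + 1) mod 3)}"
    and xy: "x < y" "y < m" "i < 3"
    unfolding quasigroup_blocks_def quasigroup_block_def by auto
  have "(i + 1) mod 3 \<noteq> i"
    using xy by presburger
  then show "B \<in> triples ({..<m} \<times> {..<3})"
    using B xy assms unfolding triples_def by auto
qed

lemma quasigroup_blockI:
  assumes "x < m" "y < m" "x \<noteq> y" "i < 3"
  shows "{(x, i), (y, i), (f (x + y), (i + 1) mod 3)} \<in> quasigroup_blocks f m"
proof (cases "x < y")
  case True
  have "quasigroup_block f ((y, x), i) \<in> quasigroup_blocks f m"
    unfolding quasigroup_blocks_def using assms True by (intro imageI) auto
  then show ?thesis
    unfolding quasigroup_block_def by simp
next
  case False
  have "quasigroup_block f ((x, y), i) \<in> quasigroup_blocks f m"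
    unfolding quasigroup_blocks_def using assms False by (intro imageI) auto
  then show ?thesis
    unfolding quasigroup_block_def by (simp add: insert_commute add.commute)
qed

text \<open>Modulo the odd number \<open>m\<close>, the factor \<open>n + 1\<close> is the inverse
  of 2, so \<open>f (x + y)\<close> is the mean of \<open>x\<close> and \<open>y\<close>: an
  idempotent commutative quasigroup. Idempotence is what the vertical blocks
  \<open>{(x, 0), (x, 1), (x, 2)}\<close> compensate for.\<close>

lemma Bose_triple_system:
  fixes n :: nat
  defines "m \<equiv> 2 * n + 1"
  shows "\<exists>\<B>. \<B> \<subseteq> triples ({..<m} \<times> {..<3::nat}) \<and> covers_pairs ({..<m} \<times> {..<3}) \<B> \<and>
    6 * card \<B> \<le> (3 * m) * (3 * m - 1)"
proof -
  define f where "f s = (s * (n + 1)) mod m" for s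
  define \<C> where "\<C> = (\<lambda>x. {(x, 0), (x, 1), (x, 2)}) ` {..<m} \<union> quasigroup_blocks f m"
  have m: "0 < m"
    unfolding m_def by simp
  have "(\<lambda>x. {(x, 0), (x, 1), (x, 2)}) ` {..<m} \<subseteq> triples ({..<m} \<times> {..<3::nat})"
    unfolding triples_def by auto
  moreover have "f s < m" for s
    using m unfolding f_def by simp
  ultimately have tri: "\<C> \<subseteq> triples ({..<m} \<times> {..<3})"
    unfolding \<C>_def using quasigroup_blocks_triples by blast
  have step: "\<exists>B\<in>\<C>. (x, i) \<in> B \<and> (y, (i + 1) mod 3) \<in> B"
    if "x < m" "y < m" "i < 3" for x y i
  proof (cases "x = y")
    case True
    have "{(x, 0), (x, 1), (x, 2)} \<in> \<C>"
      unfolding \<C>_def using that by blast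
    moreover have "i = 0 \<or> i = 1 \<or> i = 2"
      using that by linarith
    ultimately show ?thesis
      using True by (intro bexI[of _ "{(x, 0), (x, 1), (x, 2)}"]) auto
  next
    case False
    \<comment> \<open>The solution of \<open>f (x + z) = y\<close> is 2y - x modulo
      \<open>m\<close>; writing \<open>m - x\<close> avoids truncated subtraction.\<close>
    define z where "z = (2 * y + (m - x)) mod m"
    have xz: "(x + z) mod m = (2 * y) mod m"
    proof -
      have "(x + z) mod m = (x + (2 * y + (m - x))) mod m"
        unfolding z_def by (simp add: mod_add_right_eq)
      also have "x + (2 * y + (m - x)) = 2 * y + m"
        using that by simp
      finally show ?thesis
        by simp
    qed
    have half: "(2 * u * (n + 1)) mod m = u" if "u < m" for u
    proof -
      have "2 * u * (n + 1) = u + u * m"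
        unfolding m_def by (simp add: algebra_simps)
      then show ?thesis
        using that by (simp only: mod_mult_self1 mod_less)
    qed
    have f: "f (x + z) = y"
      unfolding f_def using xz half[OF that(2)] by (metis mod_mult_left_eq)
    \<comment> \<open>If \<open>x = z\<close>, idempotence would give \<open>y = x\<close>.\<close>
    have "x \<noteq> z"
    proof
      assume "x = z"
      then have "f (2 * x) = y"
        using f by (simp add: mult_2)
      then show False
        using half[OF that(1)] False unfolding f_def by simp
    qed
    moreover have "z < m"
      unfolding z_def using m by simp
    ultimately have "{(x, i), (z, i), (y, (i + 1) mod 3)} \<in> \<C>"
      using quasigroup_blockI[of x m z i f] that f unfolding \<C>_def by auto
    then show ?thesis
      by (rule bexI[rotated]) auto
  qed
  have "covers_pairs ({..<m} \<times> {..<3}) \<C>"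
    unfolding covers_pairs_def
  proof (intro ballI impI)
    fix p q :: "nat \<times> nat"
    assume pq: "p \<in> {..<m} \<times> {..<3}" "q \<in> {..<m} \<times> {..<3}" "p \<noteq> q"
    obtain x i y j where eq: "p = (x, i)" "q = (y, j)"
      by (cases p, cases q) auto
    have b: "x < m" "y < m" "i < 3" "j < 3"
      using pq eq by auto
    show "\<exists>B\<in>\<C>. p \<in> B \<and> q \<in> B"
    proof (cases "i = j")
      case True
      then have "{(x, i), (y, i), (f (x + y), (i + 1) mod 3)} \<in> \<C>"
        using quasigroup_blockI[of x m y i f] b pq eq unfolding \<C>_def by auto
      then show ?thesis
        using eq True by (auto intro: bexI[rotated])
    next
      case False
      then show ?thesis
        using other_residue_mod_3[OF b(3,4)] step[OF b(1,2,3)] step[OF b(2,1,4)] eq by auto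
    qed
  qed
  moreover have "6 * card \<C> \<le> (3 * m) * (3 * m - 1)"
  proof -
    have "card \<C> \<le> card ((\<lambda>x. {(x, 0::nat), (x, 1), (x, 2)}) ` {..<m}) + card (quasigroup_blocks f m)"
      unfolding \<C>_def by (rule card_Un_le)
    also have "card ((\<lambda>x. {(x, 0::nat), (x, 1), (x, 2)}) ` {..<m}) \<le> m"
      using card_image_le[of "{..<m}" "\<lambda>x. {(x, 0::nat), (x, 1), (x, 2)}"] by simp
    finally have "2 * card \<C> \<le> 2 * m + 3 * (m * (m - 1))"
      using card_quasigroup_blocks_le[of f m] by linarith
    then show ?thesis
      unfolding m_def by (simp add: algebra_simps)
  qed
  ultimately show ?thesis
    using tri by blast
qed

text \<open>The point at infinity is encoded as \<open>(0, 3)\<close>.\<close>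

lemma Skolem_triple_system:
  fixes n :: nat
  assumes "0 < n"
  defines "V \<equiv> insert (0, 3) ({..<2 * n} \<times> {..<3::nat})"
  shows "\<exists>\<B>. \<B> \<subseteq> triples V \<and> covers_pairs V \<B> \<and> 6 * card \<B> \<le> (6 * n + 1) * (6 * n)"
proof -
  define m where "m = 2 * n"
  \<comment> \<open>On residues, \<open>f\<close> is the permutation sending 2u to u and 2u + 1 to n
    + u. The quasigroup is half-idempotent: \<open>f (2 * x)\<close> is \<open>x mod n\<close> for
    \<open>x < m\<close>.\<close>
  define f where "f s = (s mod m) div 2 + (if odd (s mod m) then n else 0)" for s
  define \<C>\<^sub>1 where "\<C>\<^sub>1 = (\<lambda>x. {(x, 0), (x, 1), (x, 2::nat)}) ` {..<n}"
  \<comment> \<open>As the square of \<open>n + x\<close> is \<open>x\<close>, no quasigroup block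
    joins \<open>(n + x, i)\<close> to \<open>(x, (i + 1) mod 3)\<close>; the point at infinity
    completes these pairs.\<close>
  define \<C>\<^sub>2 where
    "\<C>\<^sub>2 = (\<lambda>(x, i). {(0, 3), (n + x, i), (x, (i + 1) mod 3)}) ` ({..<n} \<times> {..<3::nat})"
  define \<C> where "\<C> = \<C>\<^sub>1 \<union> \<C>\<^sub>2 \<union> quasigroup_blocks f m"
  have m: "0 < m"
    using assms(1) unfolding m_def by simp
  have V: "V = insert (0, 3) ({..<m} \<times> {..<3::nat})"
    unfolding V_def m_def ..
  have c1: "\<C>\<^sub>1 \<subseteq> triples V"
    unfolding triples_def \<C>\<^sub>1_def V_def by auto
  have c2: "\<C>\<^sub>2 \<subseteq> triples V"
  proof
    fix B assume "B \<in> \<C>\<^sub>2"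
    then obtain x i where B: "B = {(0, 3), (n + x, i), (x, (i + 1) mod 3)}" "x < n" "i < 3"
      unfolding \<C>\<^sub>2_def by auto
    have "(i + 1) mod 3 < 3"
      by simp
    then have "(i + 1) mod 3 \<noteq> 3"
      by linarith
    then show "B \<in> triples V"
      using B unfolding triples_def V_def by auto
  qed
  have flt: "f s < m" for s
  proof -
    have "s mod m < 2 * n"
      using m unfolding m_def by simp
    then show ?thesis
      unfolding f_def m_def by auto
  qed
  have "triples ({..<m} \<times> {..<3}) \<subseteq> triples V"
    unfolding triples_def V by auto
  then have tri: "\<C> \<subseteq> triples V"
    unfolding \<C>_def using quasigroup_blocks_triples[of f m] flt c1 c2 by blast
  have inf_block: "{(0, 3), (n + x, i), (x, (i + 1) mod 3)} \<in> \<C>" if "x < n" "i < 3" for x i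
  proof -
    have "(\<lambda>(x, i). {(0, 3), (n + x, i), (x, (i + 1) mod 3)}) (x, i) \<in> \<C>\<^sub>2"
      unfolding \<C>\<^sub>2_def using that by (intro imageI) auto
    then show ?thesis
      unfolding \<C>_def by simp
  qed
  have step: "\<exists>B\<in>\<C>. (x, i) \<in> B \<and> (y, (i + 1) mod 3) \<in> B"
    if "x < m" "y < m" "i < 3" for x y i
  proof -
    \<comment> \<open>The residue that \<open>f\<close> sends to \<open>y\<close>; \<open>z\<close>
      below then solves \<open>f (x + z) = y\<close>.\<close>
    define c where "c = (if y < n then 2 * y else 2 * (y - n) + 1)"
    have c: "c < m"
      using that unfolding c_def m_def by auto
    define z where "z = (c + (m - x)) mod m"
    have "(x + z) mod m = (x + (c + (m - x))) mod m"
      unfolding z_def by (simp add: mod_add_right_eq)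
    also have "x + (c + (m - x)) = c + m"
      using that by simp
    finally have xz: "(x + z) mod m = c"
      using c by simp
    have f: "f (x + z) = y"
      unfolding f_def xz c_def by auto
    show ?thesis
    proof (cases "x = z")
      case False
      moreover have "z < m"
        unfolding z_def using m by simp
      ultimately have "{(x, i), (z, i), (y, (i + 1) mod 3)} \<in> \<C>"
        using quasigroup_blockI[of x m z i f] that f unfolding \<C>_def by auto
      then show ?thesis
        by (rule bexI[rotated]) auto
    next
      \<comment> \<open>Here \<open>y\<close> is the square of \<open>x\<close>, so
        \<open>y = x mod n\<close>: either \<open>x = y\<close>, covered by a vertical block, or
        \<open>x = n + y\<close>, covered by a block through infinity.\<close>
      case True
      then have "(2 * x) mod (2 * n) = c"
        using xz unfolding m_def by (simp add: mult_2)
      then have c2: "2 * (x mod n) = c"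
        by (simp only: mult_mod_right)
      then have "even c"
        by (metis dvd_triv_left)
      then have y: "y < n"
        unfolding c_def by (auto split: if_splits)
      then have y': "y = x mod n"
        using c2 unfolding c_def by simp
      show ?thesis
      proof (cases "x < n")
        case True
        then have "{(x, 0), (x, 1), (x, 2)} \<in> \<C>"
          unfolding \<C>_def \<C>\<^sub>1_def by blast
        moreover have "i = 0 \<or> i = 1 \<or> i = 2"
          using that by linarith
        ultimately show ?thesis
          using True y' by (intro bexI[of _ "{(x, 0), (x, 1), (x, 2)}"]) auto
      next
        case False
        then have "x = n + y"
          using y' that(1) le_mod_geq[of n x] unfolding m_def by simp
        then show ?thesis
          using inf_block[OF y that(3)] by (intro bexI) auto
      qed
    qed
  qed
  have inf: "\<exists>B\<in>\<C>. (0, 3) \<in> B \<and> (x, i) \<in> B" if "x < m" "i < 3" for x i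
  proof (cases "x < n")
    case True
    \<comment> \<open>For \<open>x < n\<close>, the point \<open>(x, i)\<close> is the last one of a
      block through infinity, whose index is the level preceding \<open>i\<close>.\<close>
    have "((i + 2) mod 3 + 1) mod 3 = i" "(i + 2) mod 3 < 3"
      using that by presburger+
    then show ?thesis
      using inf_block[OF True, of "(i + 2) mod 3"] by (intro bexI) auto
  next
    case False
    then have "x - n < n" "n + (x - n) = x"
      using that unfolding m_def by auto
    then show ?thesis
      using inf_block[of "x - n" i] that by (intro bexI) auto
  qed
  have fin: "\<exists>B\<in>\<C>. p \<in> B \<and> q \<in> B"
    if pq: "p \<in> {..<m} \<times> {..<3}" "q \<in> {..<m} \<times> {..<3}" "p \<noteq> q" for p q
  proof -
    obtain x i y j where eq: "p = (x, i)" "q = (y, j)"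
      by (cases p, cases q) auto
    have b: "x < m" "y < m" "i < 3" "j < 3"
      using pq eq by auto
    show ?thesis
    proof (cases "i = j")
      case True
      then have "{(x, i), (y, i), (f (x + y), (i + 1) mod 3)} \<in> \<C>"
        using quasigroup_blockI[of x m y i f] b pq eq unfolding \<C>_def by auto
      then show ?thesis
        using eq True by (auto intro: bexI[rotated])
    next
      case False
      then show ?thesis
        using other_residue_mod_3[OF b(3,4)] step[OF b(1,2,3)] step[OF b(2,1,4)] eq by auto
    qed
  qed
  have "covers_pairs V \<C>"
    unfolding covers_pairs_def
  proof (intro ballI impI)
    fix p q :: "nat \<times> nat"
    assume pq: "p \<in> V" "q \<in> V" "p \<noteq> q"
    have inf': "\<exists>B\<in>\<C>. (0, 3) \<in> B \<and> r \<in> B" if "r \<in> {..<m} \<times> {..<3}" for r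
      using that inf by (cases r) auto
    show "\<exists>B\<in>\<C>. p \<in> B \<and> q \<in> B"
      using pq inf'[of p] inf'[of q] fin[of p q] unfolding V by blast
  qed
  moreover have "6 * card \<C> \<le> (6 * n + 1) * (6 * n)"
  proof -
    have "card \<C>\<^sub>1 \<le> card {..<n}"
      unfolding \<C>\<^sub>1_def by (intro card_image_le) auto
    moreover have "card \<C>\<^sub>2 \<le> card ({..<n} \<times> {..<3::nat})"
      unfolding \<C>\<^sub>2_def by (intro card_image_le) auto
    moreover have "card \<C> \<le> card \<C>\<^sub>1 + card \<C>\<^sub>2 + card (quasigroup_blocks f m)"
      unfolding \<C>_def
      by (rule order_trans[OF card_Un_le add_right_mono[OF card_Un_le]])
    ultimately have "2 * card \<C> \<le> 8 * n + 3 * (m * (m - 1))"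
      using card_quasigroup_blocks_le[of f m] by (simp add: card_cartesian_product)
    then show ?thesis
      using assms(1) unfolding m_def by (cases n) (auto simp: algebra_simps)
  qed
  ultimately show ?thesis
    using tri by blast
qed

section \<open>Arbitrary point sets and the size of maximum packings\<close>

text \<open>A bijection carries the concrete systems to any point set of the same size; the bound on
  the number of blocks is the form that \<open>covers_pairs_packing\<close> asks for.\<close>

lemma covers_pairs_transfer:
  assumes "finite V" "finite W" "card V = card W"
    and "\<B> \<subseteq> triples V" "covers_pairs V \<B>"
  shows "\<exists>\<C>. \<C> \<subseteq> triples W \<and> covers_pairs W \<C> \<and> card \<C> \<le> card \<B>"
proof -
  obtain h where h: "bij_betw h V W"
    using finite_same_card_bij[OF assms(1-3)] by blast
  then have inj: "inj_on h V" and img: "h ` V = W"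
    unfolding bij_betw_def by auto
  have "(`) h ` \<B> \<subseteq> triples W"
  proof (rule image_subsetI)
    fix B assume "B \<in> \<B>"
    then have B: "B \<subseteq> V" "card B = 3"
      using assms(4) unfolding triples_def by auto
    then have "card (h ` B) = 3"
      using inj by (metis card_image inj_on_subset)
    then show "h ` B \<in> triples W"
      using B img unfolding triples_def by auto
  qed
  moreover have "covers_pairs W ((`) h ` \<B>)"
    unfolding covers_pairs_def
  proof (intro ballI impI)
    fix x y assume "x \<in> W" "y \<in> W" "x \<noteq> y"
    then obtain x' y' where x': "x' \<in> V" "x = h x'" and y': "y' \<in> V" "y = h y'" and "x' \<noteq> y'"
      using img by blast
    then obtain B where "B \<in> \<B>" "x' \<in> B" "y' \<in> B"
      using assms(5) unfolding covers_pairs_def by blast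
    then show "\<exists>B\<in>(`) h ` \<B>. x \<in> B \<and> y \<in> B"
      using x' y' by blast
  qed
  moreover have "finite \<B>"
    using assms finite_triples finite_subset by blast
  ultimately show ?thesis
    using card_image_le by blast
qed

lemma steiner_triple_system_exists:
  assumes "finite V" "card V mod 6 = 1 \<or> card V mod 6 = 3" "1 < card V"
  shows "\<exists>\<B>. packing V \<B> \<and> 6 * card \<B> = card V * (card V - 1)"
proof -
  have "\<exists>\<B>. \<B> \<subseteq> triples V \<and> covers_pairs V \<B> \<and> 6 * card \<B> \<le> card V * (card V - 1)"
  proof -
    define n where "n = card V div 6"
    consider (skolem) "card V = 6 * n + 1" | (bose) "card V = 3 * (2 * n + 1)"
      using assms(2) mult_div_mod_eq[of 6 "card V"] unfolding n_def by fastforce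
    then show ?thesis
    proof cases
      case skolem
      let ?W = "insert (0, 3) ({..<2 * n} \<times> {..<3::nat})"
      obtain \<B> where \<B>: "\<B> \<subseteq> triples ?W" "covers_pairs ?W \<B>"
        "6 * card \<B> \<le> (6 * n + 1) * (6 * n)"
        using Skolem_triple_system[of n] skolem assms(3) by auto
      have "card ?W = card V"
        using skolem by (subst card_insert_disjoint) (auto simp: card_cartesian_product)
      from covers_pairs_transfer[OF _ assms(1) this \<B>(1,2)] obtain \<C>
        where "\<C> \<subseteq> triples V" "covers_pairs V \<C>" "card \<C> \<le> card \<B>"
        by blast
      moreover have "6 * card \<B> \<le> card V * (card V - 1)"
        using \<B>(3) unfolding skolem by simp
      ultimately show ?thesis
        by (meson le_trans mult_le_mono2)
    next
      case bose
      let ?W = "{..<2 * n + 1} \<times> {..<3::nat}"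
      obtain \<B> where \<B>: "\<B> \<subseteq> triples ?W" "covers_pairs ?W \<B>"
        "6 * card \<B> \<le> (3 * (2 * n + 1)) * (3 * (2 * n + 1) - 1)"
        using Bose_triple_system[of n] by blast
      have "card ?W = card V"
        using bose by (simp add: card_cartesian_product)
      from covers_pairs_transfer[OF _ assms(1) this \<B>(1,2)] obtain \<C>
        where "\<C> \<subseteq> triples V" "covers_pairs V \<C>" "card \<C> \<le> card \<B>"
        by blast
      moreover have "6 * card \<B> \<le> card V * (card V - 1)"
        using \<B>(3) unfolding bose .
      ultimately show ?thesis
        by (meson le_trans mult_le_mono2)
    qed
  qed
  then show ?thesis
    using covers_pairs_packing[OF assms(1)] by blast
qed

text \<open>Comparison with a Steiner triple system gives a maximum packing enough blocks for the
  counting argument.\<close>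

lemma maximum_packing_covers_pairs:
  assumes "finite V" "card V mod 6 = 1 \<or> card V mod 6 = 3" "1 < card V" "maximum_packing V \<A>"
  shows "covers_pairs V \<A>"
proof -
  obtain \<B> where \<B>: "packing V \<B>" "6 * card \<B> = card V * (card V - 1)"
    using steiner_triple_system_exists[OF assms(1-3)] by blast
  then have "card \<B> \<le> card \<A>"
    using assms(4) unfolding maximum_packing_def by blast
  then show ?thesis
    using assms(1,4) \<B>(2) unfolding maximum_packing_def by (intro packing_covers_pairs) auto
qed

section \<open>Neighbourhoods in a packing\<close>

definition nbrs :: "'a set set \<Rightarrow> 'a \<Rightarrow> 'a set" where
  "nbrs A x = {y. y \<noteq> x \<and> (\<exists>B\<in>A. x \<in> B \<and> y \<in> B)}"

definition deg :: "'a set set \<Rightarrow> 'a \<Rightarrow> nat" where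
  "deg A x = card {B\<in>A. x \<in> B}"

lemma nbrs_sym: "y \<in> nbrs A x \<longleftrightarrow> x \<in> nbrs A y"
  unfolding nbrs_def by auto

lemma nbrs_subset: "packing V A \<Longrightarrow> nbrs A x \<subseteq> V - {x}"
  using packing_blockD unfolding nbrs_def by fastforce

text \<open>Two blocks through \<open>x\<close> share no other point. The resulting parity of
  \<open>card (nbrs A x)\<close> is used later to exclude exactly three neighbours.\<close>

lemma card_nbrs:
  assumes "finite V" "packing V A"
  shows "card (nbrs A x) = 2 * deg A x"
proof -
  have "nbrs A x = (\<Union>B\<in>{B\<in>A. x \<in> B}. B - {x})"
    unfolding nbrs_def by auto
  moreover have "card (\<Union>B\<in>{B\<in>A. x \<in> B}. B - {x}) = (\<Sum>B\<in>{B\<in>A. x \<in> B}. card (B - {x}))"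
  proof (rule card_UN_disjoint)
    show "finite {B\<in>A. x \<in> B}"
      using packing_finite[OF assms(2,1)] by simp
    show "\<forall>B\<in>{B\<in>A. x \<in> B}. finite (B - {x})"
      using packing_blockD[OF assms(2)] assms(1) finite_subset by blast
    show "\<forall>B\<in>{B\<in>A. x \<in> B}. \<forall>C\<in>{B\<in>A. x \<in> B}. B \<noteq> C \<longrightarrow> (B - {x}) \<inter> (C - {x}) = {}"
      using packing_unique[OF assms(2), where x = x] by blast
  qed
  moreover have "card (B - {x}) = 2" if "B \<in> {B\<in>A. x \<in> B}" for B
    using packing_blockD[OF assms(2)] that by simp
  ultimately show ?thesis
    unfolding deg_def by simp
qed

lemma sum_deg:
  assumes "finite V" "packing V A" "S \<subseteq> V"
  shows "(\<Sum>x\<in>S. deg A x) = (\<Sum>B\<in>A. card (B \<inter> S))"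
  unfolding deg_def
proof (rule sum_multicount_gen)
  show "finite S" "finite A"
    using assms finite_subset packing_finite by auto
  show "\<forall>B\<in>A. card {x\<in>S. x \<in> B} = card (B \<inter> S)"
    by (auto intro!: arg_cong[where f = card])
qed

lemma handshake:
  assumes "finite V" "packing V A"
  shows "(\<Sum>x\<in>V. deg A x) = 3 * card A"
proof -
  have "card (B \<inter> V) = 3" if "B \<in> A" for B
    using packing_blockD[OF assms(2) that] by (simp add: Int_absorb2)
  then show ?thesis
    using sum_deg[OF assms, of V] by simp
qed

text \<open>A block through \<open>s\<close> is determined by any further point of \<open>S\<close>
  on it.\<close>

lemma deg_le_of_blocks_meet:
  assumes "finite S" "packing V A"
    and "\<And>B. B \<in> A \<Longrightarrow> s \<in> B \<Longrightarrow> B \<inter> (S - {s}) \<noteq> {}"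
  shows "deg A s \<le> card (S - {s})"
proof -
  \<comment> \<open>Points \<open>u\<close> on no block with \<open>s\<close> yield an arbitrary
    value, which is harmless for an inclusion into the image.\<close>
  have "{B\<in>A. s \<in> B} \<subseteq> (\<lambda>u. THE B. B \<in> A \<and> s \<in> B \<and> u \<in> B) ` (S - {s})"
  proof
    fix B assume "B \<in> {B\<in>A. s \<in> B}"
    then have B: "B \<in> A" "s \<in> B"
      by auto
    then obtain u where u: "u \<in> S - {s}" "u \<in> B"
      using assms(3) by blast
    have "(THE B. B \<in> A \<and> s \<in> B \<and> u \<in> B) = B"
      using B u packing_unique[OF assms(2), where x = s and y = u] by (intro the_equality) auto
    then show "B \<in> (\<lambda>u. THE B. B \<in> A \<and> s \<in> B \<and> u \<in> B) ` (S - {s})"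
      by (intro image_eqI[OF _ u(1)]) (rule sym)
  qed
  then show ?thesis
    unfolding deg_def using assms(1) by (intro surj_card_le) auto
qed

section \<open>Packings whose uncovered pairs have few neighbours\<close>

text \<open>Incidences between blocks and the four neighbours of \<open>y\<close> are double
  counted: at least two per block, at most two per neighbour.\<close>

lemma card_packing_le_4_of_four_nbrs:
  assumes fin: "finite V" and A: "packing V A" and v: "13 \<le> card V"
    and four: "\<And>x y. x \<in> V \<Longrightarrow> y \<in> V \<Longrightarrow> x \<noteq> y \<Longrightarrow> y \<notin> nbrs A x \<Longrightarrow> card (nbrs A x \<union> nbrs A y) \<le> 4"
    and y: "y \<in> V" "card (nbrs A y) = 4"
  shows "card A \<le> 4"
proof -
  define S where "S = nbrs A y"
  have fnbrs: "finite (nbrs A x)" for x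
    using nbrs_subset[OF A] fin finite_subset by blast
  have S: "S \<subseteq> V" "card S = 4" "finite S" "y \<notin> S"
    using nbrs_subset[OF A, of y] y(2) fnbrs unfolding S_def by auto
  have inS: "nbrs A z \<subseteq> S" if "z \<in> V" "z \<notin> S" for z
  proof (cases "z = y")
    case False
    then have "card (S \<union> nbrs A z) \<le> card S"
      using four[of y z] that y S unfolding S_def by auto
    then show ?thesis
      using S(3) fnbrs card_seteq[of "S \<union> nbrs A z" S] by auto
  qed (simp add: S_def)
  have two: "2 \<le> card (B \<inter> S)" if "B \<in> A" for B
  proof -
    have B: "B \<subseteq> V" "card B = 3" "finite B"
      using packing_blockD[OF A that] fin finite_subset by auto
    have "u = w" if "u \<in> B - S" "w \<in> B - S" for u w
    proof (rule ccontr)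
      assume "u \<noteq> w"
      then have "w \<in> nbrs A u"
        using that \<open>B \<in> A\<close> unfolding nbrs_def by auto
      then show False
        using inS[of u] that B by auto
    qed
    then have "card (B - S) \<le> 1"
      using B(3) by (subst One_nat_def, subst card_le_Suc0_iff_eq) auto
    moreover have "card B = card (B \<inter> S) + card (B - S)"
      using B(3) by (metis Int_Diff_Un Int_Diff_disjoint card_Un_disjoint finite_Diff finite_Int)
    ultimately show ?thesis
      using B(2) by linarith
  qed
  have deg2: "deg A s \<le> 2" if "s \<in> S" for s
  proof -
    \<comment> \<open>A first bound of 3, hence at most six neighbours; so \<open>s\<close> is not
      joined to everything, and \<open>four\<close> then improves the bound to 2.\<close>
    have "deg A s \<le> card (S - {s})"
    proof (rule deg_le_of_blocks_meet[OF S(3) A])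
      fix B assume B: "B \<in> A" "s \<in> B"
      show "B \<inter> (S - {s}) \<noteq> {}"
      proof
        assume "B \<inter> (S - {s}) = {}"
        then have "B \<inter> S \<subseteq> {s}"
          by auto
        then have "card (B \<inter> S) \<le> card {s}"
          by (intro card_mono) auto
        then show False
          using two[OF B(1)] by simp
      qed
    qed
    then have "card (nbrs A s) < 12"
      using that S card_nbrs[OF fin A] by simp
    moreover have "card (V - {s}) \<ge> 12"
      using v fin S(1) that by auto
    ultimately have "card (nbrs A s) < card (V - {s})"
      by (rule less_le_trans)
    then have "nbrs A s \<noteq> V - {s}"
      by (metis less_irrefl)
    then obtain z where "z \<in> V" "z \<noteq> s" "z \<notin> nbrs A s"
      using nbrs_subset[OF A, of s] by blast
    then have "card (nbrs A s \<union> nbrs A z) \<le> 4"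
      using four[of s z] that S(1) by auto
    moreover have "card (nbrs A s) \<le> card (nbrs A s \<union> nbrs A z)"
      using fnbrs by (intro card_mono) auto
    ultimately show ?thesis
      using card_nbrs[OF fin A, of s] by simp
  qed
  have "2 * card A \<le> (\<Sum>B\<in>A. card (B \<inter> S))"
    using sum_mono[of A "\<lambda>_. 2" "\<lambda>B. card (B \<inter> S)"] two by simp
  also have "\<dots> = (\<Sum>s\<in>S. deg A s)"
    using sum_deg[OF fin A S(1)] by simp
  also have "\<dots> \<le> 2 * card S"
    using sum_mono[of S "deg A" "\<lambda>_. 2"] deg2 by simp
  finally show ?thesis
    using S by simp
qed

text \<open>Once four neighbours are excluded, points that are not full have degree at most 1, and
  the handshake count leaves only a partial parallel class or the star of the unique full
  point.\<close>

lemma packing_four_nbrs_card: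
  assumes fin: "finite V" and A: "packing V A" and v: "13 \<le> card V"
    and four: "\<And>x y. x \<in> V \<Longrightarrow> y \<in> V \<Longrightarrow> x \<noteq> y \<Longrightarrow> y \<notin> nbrs A x \<Longrightarrow> card (nbrs A x \<union> nbrs A y) \<le> 4"
    and uncov: "\<not> covers_pairs V A"
  shows "3 * card A \<le> card V \<or> 2 * card A = card V - 1"
proof -
  have fnbrs: "finite (nbrs A x)" for x
    using nbrs_subset[OF A] fin finite_subset by blast
  define full where "full x \<longleftrightarrow> nbrs A x = V - {x}" for x
  have not_full: "\<exists>z\<in>V. z \<noteq> y \<and> z \<notin> nbrs A y" if "\<not> full y" for y
    using that nbrs_subset[OF A, of y] unfolding full_def by blast
  show ?thesis
  proof (cases "\<exists>y\<in>V. card (nbrs A y) = 4")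
    case True
    \<comment> \<open>At most four blocks cover at most 12 < \<open>card V\<close> points with
      multiplicity, so the first alternative holds.\<close>
    then show ?thesis
      using card_packing_le_4_of_four_nbrs[OF fin A v four] v by fastforce
  next
    case False
    have deg1: "deg A y \<le> 1" if y: "y \<in> V" "\<not> full y" for y
    proof -
      obtain z where "z \<in> V" "z \<noteq> y" "z \<notin> nbrs A y"
        using not_full[OF y(2)] by blast
      then have "card (nbrs A y \<union> nbrs A z) \<le> 4"
        using four[of y z] y by auto
      moreover have "card (nbrs A y) \<le> card (nbrs A y \<union> nbrs A z)"
        using fnbrs by (intro card_mono) auto
      moreover have "card (nbrs A y) \<noteq> 4"
        using False y by blast
      ultimately show ?thesis
        using card_nbrs[OF fin A, of y] by simp
    qed
    obtain p q where pq: "p \<in> V" "q \<in> V" "p \<noteq> q" "q \<notin> nbrs A p"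
      using uncov unfolding covers_pairs_def nbrs_def by blast
    have pq_nf: "\<not> full p" "\<not> full q"
      using pq nbrs_sym[of q A p] unfolding full_def by auto
    show ?thesis
    proof (cases "\<exists>x\<in>V. full x")
      case False
      then have "(\<Sum>y\<in>V. deg A y) \<le> card V"
        using sum_mono[of V "deg A" "\<lambda>_. 1"] deg1 by simp
      then show ?thesis
        using handshake[OF fin A] by simp
    next
      case True
      then obtain x where x: "x \<in> V" "full x"
        by blast
      have nbr: "\<exists>B\<in>A. y \<in> B \<and> u \<in> B" if "full u" "y \<in> V" "y \<noteq> u" for u y
        using that unfolding full_def nbrs_def by blast
      have uniq: "x' = x" if x': "x' \<in> V" "full x'" for x'
      proof (rule ccontr)
        assume ne: "x' \<noteq> x"
        \<comment> \<open>The only block through \<open>y\<close> must join it to both full points.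
          Applied to \<open>p\<close> and \<open>q\<close>, this puts them on the one block through
          \<open>x\<close> and \<open>x'\<close>, although they are not joined.\<close>
        have both: "\<exists>B\<in>A. y \<in> B \<and> x \<in> B \<and> x' \<in> B" if y: "y \<in> V" "\<not> full y" for y
        proof -
          obtain B C where BC: "B \<in> A" "y \<in> B" "x \<in> B" "C \<in> A" "y \<in> C" "x' \<in> C"
            using nbr[OF x(2) y(1)] nbr[OF x'(2) y(1)] y(2) x x' by metis
          have "finite {B\<in>A. y \<in> B}"
            using packing_finite[OF A fin] by simp
          then have "B = C"
            using deg1[OF y] BC card_le_Suc0_iff_eq[of "{B\<in>A. y \<in> B}"] unfolding deg_def by auto
          then show ?thesis
            using BC by blast
        qed
        obtain B C where BC: "B \<in> A" "p \<in> B" "x \<in> B" "x' \<in> B" "C \<in> A" "q \<in> C" "x \<in> C" "x' \<in> C"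
          using both[OF pq(1) pq_nf(1)] both[OF pq(2) pq_nf(2)] by metis
        then have "B = C"
          using packing_unique[OF A, of B C x x'] ne by auto
        then show False
          using BC pq unfolding nbrs_def by auto
      qed
      have "deg A y = 1" if y: "y \<in> V - {x}" for y
      proof -
        have "\<not> full y"
          using uniq y by blast
        then have "deg A y \<le> 1"
          using deg1 y by blast
        moreover have "{B\<in>A. y \<in> B} \<noteq> {}"
          using nbr[OF x(2), of y] y by blast
        then have "deg A y \<noteq> 0"
          unfolding deg_def using packing_finite[OF A fin] by simp
        ultimately show ?thesis
          by simp
      qed
      then have "(\<Sum>y\<in>V - {x}. deg A y) = card V - 1"
        using x(1) fin by simp
      then have "3 * card A = deg A x + (card V - 1)"
        using handshake[OF fin A] sum.remove[OF fin x(1), of "deg A"] by simp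
      moreover have "2 * deg A x = card V - 1"
        using card_nbrs[OF fin A, of x] x fin unfolding full_def by simp
      ultimately show ?thesis
        by linarith
    qed
  qed
qed

section \<open>The bound on the number of systems\<close>

text \<open>The third points \<open>z i\<close> of the blocks through \<open>x\<close> and
  \<open>y\<close> are distinct, since a block shared by two systems lies in \<open>A\<close>. They
  avoid the neighbours of \<open>x\<close> and \<open>y\<close>, since a block of \<open>A\<close>
  through \<open>x\<close> or \<open>y\<close> and \<open>z i\<close> would be the block
  \<open>{x, y, z i}\<close>.\<close>

lemma card_family_le_of_uncovered_pair:
  fixes \<A> :: "nat \<Rightarrow> 'a set set"
  assumes fin: "finite V"
    and pack: "\<And>i. i < t \<Longrightarrow> packing V (\<A> i)"
    and cov: "\<And>i. i < t \<Longrightarrow> covers_pairs V (\<A> i)"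
    and sub: "\<And>i. i < t \<Longrightarrow> A \<subseteq> \<A> i"
    and inter: "\<And>i j. i < t \<Longrightarrow> j < t \<Longrightarrow> i \<noteq> j \<Longrightarrow> \<A> i \<inter> \<A> j = A"
    and xy: "x \<in> V" "y \<in> V" "x \<noteq> y" "y \<notin> nbrs A x"
    and A: "packing V A"
  shows "t + card (nbrs A x \<union> nbrs A y) + 2 \<le> card V"
proof -
  have "\<exists>z. z \<noteq> x \<and> z \<noteq> y \<and> {x, y, z} \<in> \<A> i" if i: "i < t" for i
  proof -
    obtain B where B: "B \<in> \<A> i" "x \<in> B" "y \<in> B"
      using cov[OF i] xy unfolding covers_pairs_def by blast
    have "card B = 3"
      using packing_blockD[OF pack[OF i] B(1)] by simp
    then have "card (B - {x, y}) = 1"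
      using B xy by (simp add: card_Diff_subset)
    then obtain z where z: "B - {x, y} = {z}"
      by (rule card_1_singletonE)
    then have "B = {x, y, z}"
      using B by auto
    then show ?thesis
      using B z by auto
  qed
  then obtain z where z: "\<And>i. i < t \<Longrightarrow> z i \<noteq> x \<and> z i \<noteq> y \<and> {x, y, z i} \<in> \<A> i"
    by metis
  have notA: "{x, y, u} \<notin> A" for u
    using xy unfolding nbrs_def by auto
  have "inj_on z {..<t}"
  proof (rule inj_onI)
    fix i j assume ij: "i \<in> {..<t}" "j \<in> {..<t}" "z i = z j"
    then have "{x, y, z i} \<in> \<A> i \<inter> \<A> j"
      using z[of i] z[of j] by auto
    then show "i = j"
      using inter[of i j] ij notA by auto
  qed
  moreover have out: "z i \<notin> nbrs A w" if i: "i < t" and w: "w = x \<or> w = y" for i w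
  proof
    assume "z i \<in> nbrs A w"
    then obtain B where B: "B \<in> A" "w \<in> B" "z i \<in> B"
      unfolding nbrs_def by blast
    then have "B = {x, y, z i}"
      using packing_unique[OF pack[OF i], of B "{x, y, z i}" w "z i"] sub[OF i] z[OF i] w by auto
    then show False
      using B notA by simp
  qed
  moreover have "z i \<in> V" if "i < t" for i
    using packing_blockD[OF pack[OF that]] z[OF that] by blast
  ultimately have "card {..<t} \<le> card (V - ({x, y} \<union> (nbrs A x \<union> nbrs A y)))"
    using z fin by (intro card_inj_on_le[of z]) auto
  moreover have N: "nbrs A x \<union> nbrs A y \<subseteq> V - {x, y}"
    using nbrs_subset[OF A, of x] nbrs_subset[OF A, of y] xy nbrs_sym[of y A x] by auto
  then have sub': "{x, y} \<union> (nbrs A x \<union> nbrs A y) \<subseteq> V" and fN: "finite (nbrs A x \<union> nbrs A y)"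
    using xy fin finite_subset by auto
  have "card ({x, y} \<union> (nbrs A x \<union> nbrs A y)) = 2 + card (nbrs A x \<union> nbrs A y)"
    using N fN xy(3) by (subst card_Un_disjoint) auto
  moreover have "card ({x, y} \<union> (nbrs A x \<union> nbrs A y)) \<le> card V"
    using sub' fin card_mono by blast
  ultimately show ?thesis
    using card_Diff_subset[OF finite_subset[OF sub' fin] sub'] by simp
qed

lemma intersecting_family_le:
  assumes fin: "finite V" and v: "card V mod 6 = 1 \<or> card V mod 6 = 3" "13 \<le> card V"
    and k: "card V div 3 + 1 \<le> k" "k \<noteq> (card V - 1) div 2"
    and F: "intersecting_family V k t \<A>"
  shows "t \<le> card V - 7"
proof (rule ccontr)
  assume "\<not> t \<le> card V - 7"
  then have t: "card V \<le> t + 6" "2 \<le> t"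
    using v(2) by auto
  obtain A where A: "card A = k" and inter: "\<And>i j. i < t \<Longrightarrow> j < t \<Longrightarrow> i \<noteq> j \<Longrightarrow> \<A> i \<inter> \<A> j = A"
    using F unfolding intersecting_family_def by blast
  have max: "maximum_packing V (\<A> i)" if "i < t" for i
    using F that unfolding intersecting_family_def by blast
  have pack: "packing V (\<A> i)" if "i < t" for i
    using max[OF that] unfolding maximum_packing_def by blast
  have cov: "covers_pairs V (\<A> i)" if "i < t" for i
    using maximum_packing_covers_pairs[OF fin v(1) _ max[OF that]] v(2) by simp
  have sub: "A \<subseteq> \<A> i" if "i < t" for i
  proof -
    have "\<exists>j<t. j \<noteq> i"
      \<comment> \<open>A second member is required to exhibit \<open>A\<close> as an intersection
        with \<open>\<A> i\<close>.\<close>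
      using t(2) by (cases "i = 0") (auto intro: exI[of _ 1] exI[of _ 0])
    then show ?thesis
      using inter that by blast
  qed
  have packA: "packing V A"
    using packing_subset[OF pack[of 0] sub[of 0]] t by simp
  have four: "card (nbrs A x \<union> nbrs A y) \<le> 4"
    if "x \<in> V" "y \<in> V" "x \<noteq> y" "y \<notin> nbrs A x" for x y
    using card_family_le_of_uncovered_pair[of V t \<A> A x y] fin pack cov sub inter that packA t
    by auto
  \<comment> \<open>Otherwise \<open>A\<close> is itself a Steiner triple system and every member
    equals it, against the distinctness of the members.\<close>
  have "\<not> covers_pairs V A"
  proof
    assume cA: "covers_pairs V A"
    have "\<A> i = A" if i: "i < t" for i
    proof
      show "\<A> i \<subseteq> A"
      proof
        fix B assume B: "B \<in> \<A> i"
        then have "B \<subseteq> V" "card B = 3"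
          using packing_blockD[OF pack[OF i]] by auto
        then obtain x y where "x \<in> B" "y \<in> B" "x \<noteq> y"
          by (auto simp: card_3_iff)
        moreover from this obtain C where "C \<in> A" "x \<in> C" "y \<in> C"
          using cA \<open>B \<subseteq> V\<close> unfolding covers_pairs_def by blast
        ultimately show "B \<in> A"
          using packing_unique[OF pack[OF i] B, of C x y] sub[OF i] by auto
      qed
    qed (rule sub[OF i])
    then have "\<A> 0 = \<A> 1"
      using t by simp
    moreover have "inj_on \<A> {..<t}"
      using F unfolding intersecting_family_def by blast
    ultimately show False
      using t inj_onD[of \<A> "{..<t}" 0 1] by auto
  qed
  then have "3 * k \<le> card V \<or> 2 * k = card V - 1"
    using packing_four_nbrs_card[OF fin packA v(2) four] A by simp
  then show False
    using k by auto
qed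

theorem theorem2p6:
  fixes v k :: nat
  assumes "v mod 6 = 1 \<or> v mod 6 = 3"
    and "v \<ge> 13"
    and "k \<ge> v div 3 + 1"
    and "k \<noteq> (v - 1) div 2"
  shows "D v k \<le> v - 7"
proof (cases "family_sizes v k = {}")
  case True
  \<comment> \<open>The supremum of the empty set of naturals is 0.\<close>
  then show ?thesis
    unfolding D_def Sup_nat_def by simp
next
  case False
  \<comment> \<open>The supremum is attained, so the bound for families applies to
    \<open>t = D v k\<close>.\<close>
  then obtain V :: "nat set" and \<A> where "finite V" "card V = v" "intersecting_family V k (D v k) \<A>"
    using D_is_max(1) unfolding family_sizes_def by blast
  then show ?thesis
    using intersecting_family_le[of V k "D v k" \<A>] assms by simp
qed

end
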